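(* Let $H$ be a real Hilbert space with a compatible triple $(g,J,\omega)$. The maps $$\mathrm{Pol}^{\omega}(H)\to\mathfrak{D}(H),\quad W\mapsto P^{-}(P^{+}|_{W})^{-1},\qquad\qquad \mathfrak{D}(H)\to\mathrm{Pol}^{\omega}(H),\quad Z\mapsto\operatorname{graph}(Z),$$ are well-defined, and are each other's inverses.
   Context: Hilbert spaces are separable, possibly finite-dimensional. A compatible triple $(g,J,\omega)$ on a real Hilbert space $H$ consists of: a strong inner product $g$ (continuous symmetric bilinear form, $g(v,v)\ge0$, such that $v\mapsto g(v,\cdot)$ is a bounded isomorphism $H\to H^*$); a complex structure $J$ (continuous linear, $J^2=-\mathrm{id}$); and a strong symplectic form $\omega$ (continuous anti-symmetric bilinear form such that $v\mapsto\omega(v,\cdot)$ is a bounded isomorphism $H\to H^*$), with $g(v,w)=\omega(v,Jw)$. $H_{\mathbb{C}}=H\otimes_{\mathbb{R}}\mathbb{C}$, and $\alpha:H_{\mathbb{C}}\to H_{\mathbb{C}}$ is the conjugate-linear involution extending $v\otimes\lambda\mapsto v\otimes\overline\lambda$. Operators on $H$ are extended complex-linearly to $H_{\mathbb{C}}$, $g$ sesquilinearly (linear in the first entry), $\omega$ complex-bilinearly. $L^{\pm}=\ker(J\mp i)\subset H_{\mathbb{C}}$; then $H_{\mathbb{C}}=L^+\oplus L^-$ is orthogonal for $g$ and $\alpha(L^+)=L^-$. $P^\pm:H_{\mathbb{C}}\to L^\pm$ are the orthogonal projections. Adjoints and norms are taken with respect to $g$. A subspace $L\subset H_{\mathbb{C}}$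 is isotropic if $\omega$ vanishes on $L\times L$, and Lagrangian if it is isotropic and has an isotropic complement in $H_{\mathbb{C}}$. $\mathrm{Pol}^\omega(H)$ is the set of subspaces $W^+\subset H_{\mathbb{C}}$ such that $H_{\mathbb{C}}=W^+\oplus\alpha(W^+)$ is a positive symplectic polarization, i.e. a direct sum of Lagrangian subspaces such that $-i\,\omega(v,\alpha w)$ is a positive-definite sesquilinear form on $W^+$. The Siegel disk is $\mathfrak{D}(H)=\{Z\in\mathcal{B}(L^+,L^-)\mid Z=\alpha Z^*\alpha \text{ and } \mathbf{1}-Z^*Z>0\}$, where $\mathcal{B}(L^+,L^-)$ denotes bounded complex-linear operators and $T>0$ for a self-adjoint operator $T$ on $L^+$ means that there is $c>0$ with $g(x,Tx)\ge c\,g(x,x)$ for all $x\in L^+$ (so $\mathbf{1}-Z^*Z>0$ if and only if $\|Z\|<1$). For $Z\in\mathcal{B}(L^+,L^-)$, $\operatorname{graph}(Z)=\{x+Zx\mid x\in L^+\}$. *)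

theory Defs
  imports "HOL-Analysis.Analysis"
begin

section \<open>Compatible triples on a real Hilbert space\<close>

definition to_dual :: "('a::real_normed_vector \<Rightarrow> 'a \<Rightarrow> real) \<Rightarrow> 'a \<Rightarrow> ('a \<Rightarrow>\<^sub>L real)" where
  "to_dual b v = Blinfun (b v)"

definition strong_form :: "('a::real_normed_vector \<Rightarrow> 'a \<Rightarrow> real) \<Rightarrow> bool" where
  "strong_form b \<longleftrightarrow> bounded_bilinear b \<and> bounded_linear (to_dual b) \<and> bij (to_dual b)
     \<and> bounded_linear (inv (to_dual b))"

text \<open>The form \<open>g\<close> need not be the inner product of the type class; it is an
  arbitrary inner product that induces an isomorphism onto the dual space.\<close>

definition strong_inner_product :: "('a::real_normed_vector \<Rightarrow> 'a \<Rightarrow> real) \<Rightarrow> bool" where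
  "strong_inner_product g \<longleftrightarrow>
     strong_form g \<and> (\<forall>v w. g v w = g w v) \<and> (\<forall>v. 0 \<le> g v v)"

definition complex_structure :: "('a::real_normed_vector \<Rightarrow> 'a) \<Rightarrow> bool" where
  "complex_structure J \<longleftrightarrow> bounded_linear J \<and> (\<forall>v. J (J v) = - v)"

definition strong_symplectic :: "('a::real_normed_vector \<Rightarrow> 'a \<Rightarrow> real) \<Rightarrow> bool" where
  "strong_symplectic \<omega> \<longleftrightarrow> strong_form \<omega> \<and> (\<forall>v w. \<omega> v w = - \<omega> w v)"

definition compatible_triple ::
    "('a::real_normed_vector \<Rightarrow> 'a \<Rightarrow> real) \<Rightarrow> ('a \<Rightarrow> 'a) \<Rightarrow> ('a \<Rightarrow> 'a \<Rightarrow> real) \<Rightarrow> bool" where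
  "compatible_triple g J \<omega> \<longleftrightarrow>
     strong_inner_product g \<and> complex_structure J \<and> strong_symplectic \<omega>
     \<and> (\<forall>v w. g v w = \<omega> v (J w))"

section \<open>The complexification\<close>

text \<open>The complexification of \<open>H\<close> is modelled on \<open>H \<times> H\<close>: the pair \<open>(x, y)\<close> stands
  for \<open>x \<otimes> 1 + y \<otimes> \<i>\<close>.\<close>

definition cscale :: "complex \<Rightarrow> 'a::real_vector \<times> 'a \<Rightarrow> 'a \<times> 'a" (infixr \<open>*\<^sub>c\<close> 75) where
  "c *\<^sub>c v = (Re c *\<^sub>R fst v - Im c *\<^sub>R snd v, Im c *\<^sub>R fst v + Re c *\<^sub>R snd v)"

interpretation cvs: vector_space "cscale :: complex \<Rightarrow> 'a::real_vector \<times> 'a \<Rightarrow> 'a \<times> 'a"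
  by unfold_locales (simp_all add: cscale_def prod_eq_iff algebra_simps)

definition cconj :: "'a::real_vector \<times> 'a \<Rightarrow> 'a \<times> 'a" where
  "cconj v = (fst v, - snd v)"

definition ext_op :: "('a \<Rightarrow> 'a) \<Rightarrow> 'a \<times> 'a \<Rightarrow> 'a \<times> 'a" where
  "ext_op T v = (T (fst v), T (snd v))"

text \<open>Sesquilinear extension, linear in the first argument.\<close>

definition ext_sesq :: "('a \<Rightarrow> 'a \<Rightarrow> real) \<Rightarrow> 'a \<times> 'a \<Rightarrow> 'a \<times> 'a \<Rightarrow> complex" where
  "ext_sesq b v w = Complex (b (fst v) (fst w) + b (snd v) (snd w))
                            (b (snd v) (fst w) - b (fst v) (snd w))"

text \<open>Complex bilinear extension.\<close>

definition ext_bilin :: "('a \<Rightarrow> 'a \<Rightarrow> real) \<Rightarrow> 'a \<times> 'a \<Rightarrow> 'a \<times> 'a \<Rightarrow> complex" where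
  "ext_bilin b v w = Complex (b (fst v) (fst w) - b (snd v) (snd w))
                             (b (snd v) (fst w) + b (fst v) (snd w))"

definition Lplus :: "('a::real_vector \<Rightarrow> 'a) \<Rightarrow> ('a \<times> 'a) set" where
  "Lplus J = {v. ext_op J v - \<i> *\<^sub>c v = 0}"

definition Lminus :: "('a::real_vector \<Rightarrow> 'a) \<Rightarrow> ('a \<times> 'a) set" where
  "Lminus J = {v. ext_op J v + \<i> *\<^sub>c v = 0}"

definition orth_proj ::
    "('a::real_vector \<Rightarrow> 'a \<Rightarrow> real) \<Rightarrow> ('a \<times> 'a) set \<Rightarrow> 'a \<times> 'a \<Rightarrow> 'a \<times> 'a" where
  "orth_proj g L v = (THE p. p \<in> L \<and> (\<forall>w\<in>L. ext_sesq g (v - p) w = 0))"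

definition Pplus :: "('a::real_vector \<Rightarrow> 'a \<Rightarrow> real) \<Rightarrow> ('a \<Rightarrow> 'a) \<Rightarrow> 'a \<times> 'a \<Rightarrow> 'a \<times> 'a" where
  "Pplus g J = orth_proj g (Lplus J)"

definition Pminus :: "('a::real_vector \<Rightarrow> 'a \<Rightarrow> real) \<Rightarrow> ('a \<Rightarrow> 'a) \<Rightarrow> 'a \<times> 'a \<Rightarrow> 'a \<times> 'a" where
  "Pminus g J = orth_proj g (Lminus J)"

section \<open>Positive symplectic polarizations\<close>

definition direct_sum :: "('a::real_vector \<times> 'a) set \<Rightarrow> ('a \<times> 'a) set \<Rightarrow> bool" where
  "direct_sum V W \<longleftrightarrow> V \<inter> W = {0} \<and> (\<forall>x. \<exists>v\<in>V. \<exists>w\<in>W. x = v + w)"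

definition isotropic :: "('a \<Rightarrow> 'a \<Rightarrow> real) \<Rightarrow> ('a \<times> 'a) set \<Rightarrow> bool" where
  "isotropic \<omega> L \<longleftrightarrow> (\<forall>v\<in>L. \<forall>w\<in>L. ext_bilin \<omega> v w = 0)"

text \<open>No closedness is imposed on subspaces: for a strong symplectic form an isotropic
  subspace with an isotropic complement equals its own symplectic annihilator.\<close>

definition lagrangian :: "('a::real_vector \<Rightarrow> 'a \<Rightarrow> real) \<Rightarrow> ('a \<times> 'a) set \<Rightarrow> bool" where
  "lagrangian \<omega> L \<longleftrightarrow> cvs.subspace L \<and> isotropic \<omega> L
     \<and> (\<exists>L'. cvs.subspace L' \<and> isotropic \<omega> L' \<and> direct_sum L L')"

definition pos_def_on :: "('v::zero \<Rightarrow> 'v \<Rightarrow> complex) \<Rightarrow> 'v set \<Rightarrow> bool" where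
  "pos_def_on h W \<longleftrightarrow> (\<forall>v\<in>W. v \<noteq> 0 \<longrightarrow> h v v \<in> \<real> \<and> 0 < Re (h v v))"

definition Pol :: "('a::real_vector \<Rightarrow> 'a \<Rightarrow> real) \<Rightarrow> ('a \<times> 'a) set set" where
  "Pol \<omega> = {W. lagrangian \<omega> W \<and> lagrangian \<omega> (cconj ` W) \<and> direct_sum W (cconj ` W)
               \<and> pos_def_on (\<lambda>v w. - \<i> * ext_bilin \<omega> v (cconj w)) W}"

section \<open>The Siegel disk\<close>

definition gnorm :: "('a \<Rightarrow> 'a \<Rightarrow> real) \<Rightarrow> 'a \<times> 'a \<Rightarrow> real" where
  "gnorm g v = sqrt (Re (ext_sesq g v v))"

text \<open>Operators between subspaces \<open>V\<close> and \<open>W\<close> are functions that are \<open>undefined\<close>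
  outside \<open>V\<close>, so that equality of operators is equality of functions.\<close>

definition bounded_ops ::
    "('a::real_vector \<Rightarrow> 'a \<Rightarrow> real) \<Rightarrow> ('a \<times> 'a) set \<Rightarrow> ('a \<times> 'a) set \<Rightarrow> ('a \<times> 'a \<Rightarrow> 'a \<times> 'a) set"
  where
  "bounded_ops g V W = {T \<in> V \<rightarrow>\<^sub>E W.
     (\<forall>x\<in>V. \<forall>y\<in>V. T (x + y) = T x + T y) \<and> (\<forall>c. \<forall>x\<in>V. T (c *\<^sub>c x) = c *\<^sub>c T x)
     \<and> (\<exists>K. \<forall>x\<in>V. gnorm g (T x) \<le> K * gnorm g x)}"

text \<open>The adjoint \<open>W \<rightarrow> V\<close> of an operator \<open>T : V \<rightarrow> W\<close>.\<close>

definition adj ::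
    "('a \<Rightarrow> 'a \<Rightarrow> real) \<Rightarrow> ('a \<times> 'a) set \<Rightarrow> ('a \<times> 'a) set
      \<Rightarrow> ('a \<times> 'a \<Rightarrow> 'a \<times> 'a) \<Rightarrow> 'a \<times> 'a \<Rightarrow> 'a \<times> 'a" where
  "adj g V W T = (\<lambda>y\<in>W. THE z. z \<in> V \<and> (\<forall>x\<in>V. ext_sesq g (T x) y = ext_sesq g x z))"

text \<open>Only used for self-adjoint \<open>T\<close>, for which \<open>ext_sesq g x (T x)\<close> is real.\<close>

definition pos_op ::
    "('a \<Rightarrow> 'a \<Rightarrow> real) \<Rightarrow> ('a \<times> 'a) set \<Rightarrow> ('a \<times> 'a \<Rightarrow> 'a \<times> 'a) \<Rightarrow> bool" where
  "pos_op g V T \<longleftrightarrow>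
     (\<exists>c>0. \<forall>x\<in>V. c * Re (ext_sesq g x x) \<le> Re (ext_sesq g x (T x)))"

definition siegel_disk ::
    "('a::real_vector \<Rightarrow> 'a \<Rightarrow> real) \<Rightarrow> ('a \<Rightarrow> 'a) \<Rightarrow> ('a \<times> 'a \<Rightarrow> 'a \<times> 'a) set" where
  "siegel_disk g J = {Z \<in> bounded_ops g (Lplus J) (Lminus J).
     (\<forall>x\<in>Lplus J. Z x = cconj (adj g (Lplus J) (Lminus J) Z (cconj x)))
     \<and> pos_op g (Lplus J) (\<lambda>x. x - adj g (Lplus J) (Lminus J) Z (Z x))}"

definition pol_to_disk ::
    "('a::real_vector \<Rightarrow> 'a \<Rightarrow> real) \<Rightarrow> ('a \<Rightarrow> 'a) \<Rightarrow> ('a \<times> 'a) set \<Rightarrow> 'a \<times> 'a \<Rightarrow> 'a \<times> 'a" where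
  "pol_to_disk g J W = (\<lambda>x\<in>Lplus J. Pminus g J (inv_into W (Pplus g J) x))"

definition graph ::
    "('a::real_vector \<Rightarrow> 'a) \<Rightarrow> ('a \<times> 'a \<Rightarrow> 'a \<times> 'a) \<Rightarrow> ('a \<times> 'a) set" where
  "graph J Z = {x + Z x |x. x \<in> Lplus J}"

end

theory Submission
  imports Defs
begin

text \<open>
  On the complexification let \<open>S = - \<i> J\<close> (\<open>grading\<close>). Since \<open>J\<close> preserves \<open>g\<close>, the operator \<open>S\<close> is
  a self-adjoint involution with eigenspaces \<open>L\<^sup>+\<close> and \<open>L\<^sup>-\<close>, and the sesquilinear form
  \<open>h v w = - \<i> \<omega> (v, \<alpha> w)\<close> equals \<open>g (S v, w)\<close>. So \<open>h v v\<close> is the difference of the squared norms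
  of \<open>P\<^sup>+ v\<close> and \<open>P\<^sup>- v\<close>, and \<open>\<alpha>\<close> changes the sign of \<open>h\<close>. In terms of \<open>h\<close>, a
  subspace \<open>W\<close> is a positive symplectic polarization when \<open>h\<close> vanishes on \<open>W \<times> \<alpha> W\<close> (both
  summands are isotropic), \<open>h > 0\<close> on \<open>W\<close>, and \<open>W \<oplus> \<alpha> W\<close> is everything (\<open>Pol_iff\<close>).

  Consequently \<open>P\<^sup>+\<close> is injective on \<open>W\<close>, because \<open>h \<le> 0\<close> on its kernel, and \<open>W\<close> is the graph of
  \<open>Z = P\<^sup>- (P\<^sup>+|\<^sub>W)\<inverse>\<close>. Isotropy of a graph is the same as \<open>Z = \<alpha> Z\<^sup>* \<alpha>\<close> (\<open>h_graph\<close>), and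
  \<open>h\<close> on \<open>x + Z x\<close> is the quadratic form of \<open>1 - Z\<^sup>* Z\<close> at \<open>x\<close>. What remains is analysis, at
  three places.

  The Siegel disk asks for a uniform bound \<open>\<parallel>Z\<parallel> < 1\<close>, whereas a polarization is only
  pointwise positive. The unit ball of \<open>(W, h)\<close> is weakly bounded: against \<open>h\<close>, a vector
  \<open>w\<^sub>0 + \<alpha> w\<^sub>1\<close> acts on \<open>W\<close> only through \<open>w\<^sub>0\<close>, and the Cauchy--Schwarz inequality for \<open>h\<close> on \<open>W\<close>
  applies. By the uniform boundedness principle it is bounded, so \<open>h\<close> is coercive on \<open>W\<close>
  (\<open>h_coercive\<close>).

  The projection \<open>P\<^sup>+\<close> maps \<open>W\<close> onto \<open>L\<^sup>+\<close>: if \<open>Q\<close> is the projection to \<open>W\<close> along \<open>\<alpha> W\<close>, then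
  \<open>P\<^sup>+ Q\<close> on \<open>L\<^sup>+\<close> ought to be \<open>(1 - Z\<^sup>* Z)\<inverse>\<close>, which is strictly positive. Coercivity of \<open>h\<close> shows
  that \<open>1 - c P\<^sup>+ Q\<close> is a strict contraction for small \<open>c\<close>, and a Neumann series inverts
  \<open>c P\<^sup>+ Q\<close> (\<open>Pol_pplus_surj\<close>).

  Conversely, for \<open>Z\<close> in the disk, \<open>graph Z + \<alpha> (graph Z)\<close> is the range of
  \<open>1 + (Z \<oplus> \<alpha> Z \<alpha>)\<close> on \<open>L\<^sup>+ \<oplus> L\<^sup>-\<close>, a strict contraction added to the identity, hence everything
  (\<open>graph_in_Pol\<close>).
\<close>

section \<open>Functional analysis: uniform boundedness, Neumann series, Cauchy--Schwarz\<close>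

text \<open>
  The sets on which the family is bounded by \<open>n\<close> are closed and cover the space, so by
  Baire's theorem one of them contains a ball; by linearity a bound on a ball gives a bound
  on the operator norms.
\<close>

lemma uniform_boundedness_principle:
  fixes F :: "('v::{real_normed_vector, complete_space} \<Rightarrow> 'w::real_normed_vector) set"
  assumes lin: "\<And>f. f \<in> F \<Longrightarrow> bounded_linear f"
    and ptw: "\<And>x. \<exists>C. \<forall>f\<in>F. norm (f x) \<le> C"
  shows "\<exists>K\<ge>0. \<forall>f\<in>F. \<forall>x. norm (f x) \<le> K * norm x"
proof -
  define A where "A n = {x. \<forall>f\<in>F. norm (f x) \<le> real n}" for n
  have A_eq: "A n = (\<Inter>f\<in>F. {x. norm (f x) \<le> real n})" for n
    by (auto simp: A_def)
  have closed: "closed (A n)" for n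
    unfolding A_eq
    by (intro closed_INT ballI closed_Collect_le continuous_intros
        bounded_linear.continuous_on[OF lin] continuous_on_const) auto
  have "\<exists>n. x \<in> A n" for x
  proof -
    obtain C where "\<forall>f\<in>F. norm (f x) \<le> C" using ptw by blast
    moreover obtain n where "C \<le> real n" using real_arch_simple by blast
    ultimately show ?thesis unfolding A_def by (auto intro!: exI[of _ n] intro: order_trans)
  qed
  hence cover: "\<Union>(range A) = UNIV" by auto
  have "\<exists>n. interior (A n) \<noteq> {}"
  proof (rule ccontr)
    assume "\<nexists>n. interior (A n) \<noteq> {}"
    hence "euclidean interior_of \<Union>(range A) = {}"
      using closed
      by (intro Baire_category_alt) (auto simp: completely_metrizable_space_euclidean)
    thus False using cover by simp
  qed
  then obtain n z where "z \<in> interior (A n)" by blast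
  then obtain e where e: "e > 0" "cball z e \<subseteq> A n"
    using mem_interior_cball by blast
  have bnd: "norm (f x) \<le> 2 * real n / e * norm x" if f: "f \<in> F" for f x
  proof (cases "x = 0")
    case True
    then show ?thesis using linear_0[OF bounded_linear.linear[OF lin[OF f]]] by simp
  next
    case False
    interpret bounded_linear f by (rule lin[OF f])
    define t where "t = e / norm x"
    have t: "t > 0" using e False by (simp add: t_def)
    have "z + t *\<^sub>R x \<in> cball z e" "z \<in> cball z e"
      using e False by (auto simp: dist_norm t_def)
    hence "z + t *\<^sub>R x \<in> A n" "z \<in> A n" using e(2) by blast+
    hence "norm (f (z + t *\<^sub>R x)) \<le> n" "norm (f z) \<le> n"
      using f by (auto simp: A_def)
    moreover have "f (t *\<^sub>R x) = f (z + t *\<^sub>R x) - f z" by (simp add: add)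
    ultimately have "norm (f (t *\<^sub>R x)) \<le> 2 * real n"
      using norm_triangle_ineq4[of "f (z + t *\<^sub>R x)" "f z"] by simp
    hence "t * norm (f x) \<le> 2 * real n" using t by (simp add: scaleR)
    thus ?thesis using e False by (simp add: t_def field_simps)
  qed
  have "2 * real n / e \<ge> 0" using e by simp
  thus ?thesis using bnd by blast
qed

text \<open>
  The solution is \<open>\<Sum>n. (E ^^ n) y\<close>. The hypothesis is decay of the orbit of \<open>y\<close>, not a bound on the
  norm of \<open>E\<close>: below, \<open>E\<close> contracts an equivalent norm, and the given norm is controlled only
  up to a constant.
\<close>

lemma Neumann_surj:
  fixes E :: "'v::{real_normed_vector, complete_space} \<Rightarrow> 'v"
  assumes E: "bounded_linear E"
    and r: "0 \<le> r" "r < 1"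
    and decay: "\<And>n. norm ((E ^^ n) y) \<le> C * r ^ n"
  shows "\<exists>x. x - E x = y"
proof -
  interpret bounded_linear E by (rule E)
  define S where "S n = (\<Sum>k<n. (E ^^ k) y)" for n
  define R where "R n = (\<Sum>k<n. C * r ^ k)" for n
  have "convergent R"
    unfolding R_def using r
    by (intro summable_iff_convergent[THEN iffD1] summable_mult summable_geometric) auto
  hence "Cauchy R" by (rule convergent_Cauchy)
  have dist_le: "dist (S i) (S j) \<le> dist (R i) (R j)" for i j
  proof -
    have aux: "dist (S i) (S j) \<le> dist (R i) (R j)" if "i \<le> j" for i j
    proof -
      have "S j - S i = (\<Sum>k=i..<j. (E ^^ k) y)" "R j - R i = (\<Sum>k=i..<j. C * r ^ k)"
        using that unfolding S_def R_def
        by (simp_all add: sum_diff_nat_ivl[of 0 i j, symmetric] lessThan_atLeast0)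
      moreover have "norm (\<Sum>k=i..<j. (E ^^ k) y) \<le> (\<Sum>k=i..<j. C * r ^ k)"
        by (rule sum_norm_le) (rule decay)
      ultimately show ?thesis
        by (metis abs_ge_self dist_commute dist_norm order_trans real_norm_def)
    qed
    show ?thesis
      using aux[of i j] aux[of j i] by (cases "i \<le> j") (auto simp: dist_commute)
  qed
  have "Cauchy S"
    using \<open>Cauchy R\<close> dist_le unfolding Cauchy_def by (meson le_less_trans)
  then obtain x where x: "S \<longlonglongrightarrow> x"
    using Cauchy_convergent convergent_def by blast
  have "E (S n) = S (Suc n) - y" for n
  proof -
    have "S (Suc n) = y + (\<Sum>k<n. (E ^^ Suc k) y)"
      unfolding S_def by (subst sum.lessThan_Suc_shift) simp
    thus ?thesis by (simp add: S_def sum)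
  qed
  moreover have "(\<lambda>n. E (S n)) \<longlonglongrightarrow> E x" by (rule tendsto) (rule x)
  moreover have "(\<lambda>n. S (Suc n) - y) \<longlonglongrightarrow> x - y"
    by (intro tendsto_intros LIMSEQ_Suc x)
  ultimately have "E x = x - y" using LIMSEQ_unique by simp
  thus ?thesis by (intro exI[of _ x]) simp
qed

text \<open>
  The form is required to be semidefinite only on a subspace, so that the lemma applies to
  a positive subspace of an indefinite form.
\<close>

lemma Cauchy_Schwarz_semidefinite:
  fixes b :: "'v::real_vector \<Rightarrow> 'v \<Rightarrow> real"
  assumes "bilinear b" and sym: "\<And>v w. b v w = b w v"
    and sub: "subspace S" and nonneg: "\<And>v. v \<in> S \<Longrightarrow> 0 \<le> b v v"
    and S: "v \<in> S" "w \<in> S"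
  shows "(b v w)\<^sup>2 \<le> b v v * b w w"
proof -
  note bil = bilinear_ladd[OF \<open>bilinear b\<close>] bilinear_radd[OF \<open>bilinear b\<close>]
    bilinear_lmul[OF \<open>bilinear b\<close>] bilinear_rmul[OF \<open>bilinear b\<close>]
  have *: "0 \<le> b v v + 2 * t * b v w + t\<^sup>2 * b w w" for t
  proof -
    have "0 \<le> b (v + t *\<^sub>R w) (v + t *\<^sub>R w)"
      using sub S by (intro nonneg subspace_add subspace_scale)
    thus ?thesis by (simp add: bil sym[of w v] algebra_simps power2_eq_square)
  qed
  show ?thesis
  proof (cases "b w w = 0")
    case True
    have "b v w = 0"
    proof (rule ccontr)
      assume "b v w \<noteq> 0"
      \<comment> \<open>the quadratic polynomial is then affine in \<open>t\<close>; at this \<open>t\<close> it is \<open>- 1\<close>\<close>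
      thus False using *[of "- (b v v + 1) / (2 * b v w)"] True by (simp add: field_simps)
    qed
    thus ?thesis using True by simp
  next
    case False
    hence pos: "b w w > 0" using nonneg[OF S(2)] by simp
    \<comment> \<open>the minimum of the quadratic polynomial, scaled by \<open>b w w\<close>\<close>
    have "0 \<le> b w w * (b v v + 2 * (- b v w / b w w) * b v w + (- b v w / b w w)\<^sup>2 * b w w)"
      using pos *[of "- b v w / b w w"] by (intro mult_nonneg_nonneg) auto
    thus ?thesis using pos by (simp add: field_simps power2_eq_square)
  qed
qed

section \<open>Subspaces and conjugation on the complexification\<close>

lemma scaleR_eq_cscale: "r *\<^sub>R v = complex_of_real r *\<^sub>c v"
  by (simp add: cscale_def prod_eq_iff)

lemma cvs_subspace_imp_subspace: "cvs.subspace W \<Longrightarrow> subspace W"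
  by (simp add: subspace_def cvs.subspace_def scaleR_eq_cscale)

lemma cconj_cconj [simp]: "cconj (cconj v) = v"
  by (simp add: cconj_def)

lemma cconj_add: "cconj (v + w) = cconj v + cconj w"
  by (simp add: cconj_def)

lemma cconj_scaleR: "cconj (r *\<^sub>R v) = r *\<^sub>R cconj v"
  by (simp add: cconj_def)

lemma cconj_cscale: "cconj (c *\<^sub>c v) = cnj c *\<^sub>c cconj v"
  by (simp add: cconj_def cscale_def algebra_simps)

lemma cconj_zero [simp]: "cconj 0 = 0"
  by (simp add: cconj_def prod_eq_iff)

lemma cvs_subspace_cconj: 
  assumes "cvs.subspace W" shows "cvs.subspace (cconj ` W)"
  unfolding cvs.subspace_def
proof (intro conjI ballI allI)
  show "0 \<in> cconj ` W" using cvs.subspace_0[OF assms] by force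
next
  fix x y assume "x \<in> cconj ` W" "y \<in> cconj ` W"
  thus "x + y \<in> cconj ` W"
    using cvs.subspace_add[OF assms] by (auto simp flip: cconj_add)
next
  fix c x assume "x \<in> cconj ` W"
  then obtain w where "w \<in> W" "x = cconj w" by auto
  thus "c *\<^sub>c x \<in> cconj ` W"
    using cvs.subspace_scale[OF assms, of w "cnj c"]
    by (intro image_eqI[of _ _ "cnj c *\<^sub>c w"]) (auto simp: cconj_cscale)
qed

lemma direct_sum_commute: "direct_sum V W \<Longrightarrow> direct_sum W V"
  unfolding direct_sum_def by (metis Int_commute add.commute)

lemma direct_sum_projection:
  assumes V: "subspace V" and W: "subspace W" and sum: "direct_sum V W"
  obtains Q where "linear Q" "\<And>x. Q x \<in> V" "\<And>x. x - Q x \<in> W"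
proof -
  have "\<exists>v. v \<in> V \<and> x - v \<in> W" for x
    using sum unfolding direct_sum_def by (metis add_diff_cancel_left')
  then obtain Q where Q: "\<And>x. Q x \<in> V" "\<And>x. x - Q x \<in> W" by metis
  have uniq: "Q x = v" if "v \<in> V" "x - v \<in> W" for x v
  proof -
    have "Q x - v \<in> V" using V Q that by (simp add: subspace_diff)
    moreover have "Q x - v \<in> W" using subspace_diff[OF W that(2) Q(2), of x] by simp
    ultimately have "Q x - v \<in> {0}" using sum unfolding direct_sum_def by (metis IntI)
    thus ?thesis by simp
  qed
  have "Q (x + y) = Q x + Q y" for x y
  proof (rule uniq)
    show "Q x + Q y \<in> V" using V Q by (simp add: subspace_add)
    have "(x - Q x) + (y - Q y) \<in> W" using W Q by (simp add: subspace_add)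
    thus "x + y - (Q x + Q y) \<in> W" by (simp add: algebra_simps)
  qed
  moreover have "Q (r *\<^sub>R x) = r *\<^sub>R Q x" for r x
  proof (rule uniq)
    show "r *\<^sub>R Q x \<in> V" using V Q by (simp add: subspace_scale)
    have "r *\<^sub>R (x - Q x) \<in> W" by (rule subspace_scale[OF W Q(2)])
    thus "r *\<^sub>R x - r *\<^sub>R Q x \<in> W" by (simp add: algebra_simps)
  qed
  ultimately have "linear Q" by (intro linearI)
  thus ?thesis using that Q by blast
qed

section \<open>The indefinite form of a compatible triple\<close>

text \<open>
  The type carries some complete norm; the geometry is that of \<open>g\<close>, whose norm is equivalent to
  it by \<open>g_coercive\<close>.
\<close>

locale compatible =
  fixes g :: "'a::{real_normed_vector, complete_space} \<Rightarrow> 'a \<Rightarrow> real"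
    and J :: "'a \<Rightarrow> 'a"
    and \<omega> :: "'a \<Rightarrow> 'a \<Rightarrow> real"
  assumes triple: "compatible_triple g J \<omega>"
begin

lemma bounded_bilinear_g: "bounded_bilinear g"
  using triple unfolding compatible_triple_def strong_inner_product_def strong_form_def by blast+

sublocale g: bounded_bilinear g by (rule bounded_bilinear_g)

lemma bounded_linear_J: "bounded_linear J"
  using triple unfolding compatible_triple_def complex_structure_def by blast+

sublocale J: bounded_linear J by (rule bounded_linear_J)

lemma J_J [simp]: "J (J v) = - v"
  using triple unfolding compatible_triple_def complex_structure_def by blast+

lemma g_sym: "g v w = g w v"
  using triple unfolding compatible_triple_def strong_inner_product_def by blast+

lemma g_nonneg: "0 \<le> g v v"
  using triple unfolding compatible_triple_def strong_inner_product_def by blast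

lemma \<omega>_eq: "\<omega> v w = g (J v) w"
  and g_J_left: "g (J v) w = - g v (J w)"
proof -
  have compat: "g v w = \<omega> v (J w)" and skew: "\<omega> v w = - \<omega> w v" for v w
    using triple unfolding compatible_triple_def strong_symplectic_def by blast+
  interpret \<omega>: bounded_bilinear \<omega>
    using triple unfolding compatible_triple_def strong_symplectic_def strong_form_def by blast+
  have "g (J v) w = g w (J v)" by (rule g_sym)
  also have "\<dots> = - \<omega> w v" by (simp add: compat \<omega>.minus_right)
  also have "\<dots> = \<omega> v w" by (simp add: skew[of v w])
  finally show "\<omega> v w = g (J v) w" ..
  moreover have "\<omega> v w = - g v (J w)" by (simp add: compat \<omega>.minus_right)
  ultimately show "g (J v) w = - g v (J w)" by simp
qed

text \<open>
  Since \<open>g\<close> is strong, \<open>norm v\<close> is at most a constant times the norm of \<open>g v\<close> in the dual, and by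
  the Cauchy--Schwarz inequality the latter is at most a constant times \<open>sqrt (g v v)\<close>. This is also
  where definiteness of \<open>g\<close> comes from.
\<close>

lemma g_coercive: "\<exists>m>0. \<forall>v. m * (norm v)\<^sup>2 \<le> g v v"
proof -
  have bl: "bounded_linear (g v)" for v by (rule g.bounded_linear_right)
  have strong: "bounded_linear (to_dual g)" "bij (to_dual g)" "bounded_linear (inv (to_dual g))"
    using triple unfolding compatible_triple_def strong_inner_product_def strong_form_def by blast+
  have app: "blinfun_apply (to_dual g v) w = g v w" for v w
    unfolding to_dual_def using bl by (simp add: bounded_linear_Blinfun_apply)
  obtain K where K: "K > 0" "\<And>f. norm (inv (to_dual g) f) \<le> norm f * K"
    using bounded_linear.pos_bounded[OF strong(3)] by blast
  obtain M where M: "M > 0" "\<And>a b. norm (g a b) \<le> norm a * norm b * M"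
    using g.pos_bounded by blast
  have "bilinear g"
    by (auto simp: bilinear_def intro!: bounded_linear.linear g.bounded_linear_left g.bounded_linear_right)
  note CS = Cauchy_Schwarz_semidefinite[OF this g_sym subspace_UNIV g_nonneg UNIV_I UNIV_I]
  have "(norm v)\<^sup>2 \<le> (K\<^sup>2 * M) * g v v" for v
  proof -
    have "norm (to_dual g v) \<le> sqrt (M * g v v)"
    proof (rule norm_blinfun_bound)
      show "0 \<le> sqrt (M * g v v)" using M g_nonneg by simp
      fix w
      have "(g v w)\<^sup>2 \<le> g v v * g w w" by (rule CS)
      also have "\<dots> \<le> g v v * (norm w * norm w * M)"
        using M(2)[of w w] g_nonneg[of v] by (intro mult_left_mono) auto
      finally have "(g v w)\<^sup>2 \<le> (M * g v v) * (norm w)\<^sup>2"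
        by (simp add: power2_eq_square mult_ac)
      hence "sqrt ((g v w)\<^sup>2) \<le> sqrt ((M * g v v) * (norm w)\<^sup>2)" by (rule real_sqrt_le_mono)
      thus "norm (blinfun_apply (to_dual g v) w) \<le> sqrt (M * g v v) * norm w"
        by (simp add: app real_sqrt_mult)
    qed
    moreover have "norm v \<le> norm (to_dual g v) * K"
      using K(2)[of "to_dual g v"] strong(2) by (simp add: bij_is_inj)
    ultimately have "norm v \<le> sqrt (M * g v v) * K"
      using K(1) by (meson mult_right_mono less_imp_le order_trans)
    hence "(norm v)\<^sup>2 \<le> (sqrt (M * g v v) * K)\<^sup>2" by (intro power_mono) auto
    thus ?thesis using M(1) g_nonneg[of v] by (simp add: power_mult_distrib mult_ac)
  qed
  moreover have "K\<^sup>2 * M > 0" using K M by simp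
  ultimately have "1 / (K\<^sup>2 * M) > 0" "\<forall>v. 1 / (K\<^sup>2 * M) * (norm v)\<^sup>2 \<le> g v v"
    by (simp_all add: pos_divide_le_eq mult.commute)
  thus ?thesis by blast
qed

abbreviation G where "G \<equiv> ext_sesq g"

lemma G_linear:
  "G (u + v) w = G u w + G v w" "G u (v + w) = G u v + G u w"
  "G (u - v) w = G u w - G v w" "G u (v - w) = G u v - G u w"
  "G (- v) w = - G v w" "G v (- w) = - G v w"
  by (simp_all add: ext_sesq_def complex_eq_iff g.add_left g.add_right g.diff_left g.diff_right
      g.minus_left g.minus_right)

lemma G_zero [simp]: "G 0 w = 0" "G v 0 = 0"
  by (simp_all add: ext_sesq_def complex_eq_iff g.zero_left g.zero_right)

lemma G_scale [simp]:
  "G (c *\<^sub>c v) w = c * G v w" "G v (c *\<^sub>c w) = cnj c * G v w"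
  "G (r *\<^sub>R v) w = r * G v w" "G v (r *\<^sub>R w) = r * G v w"
  by (simp_all add: ext_sesq_def cscale_def complex_eq_iff g.add_left g.add_right g.diff_left g.diff_right
      g.scaleR_left g.scaleR_right algebra_simps)

lemma G_cnj: "cnj (G v w) = G w v"
  by (simp add: ext_sesq_def complex_eq_iff g_sym[of "fst w" "fst v"] g_sym[of "fst w" "snd v"]
      g_sym[of "snd w" "fst v"] g_sym[of "snd w" "snd v"])

lemma G_cconj: "G (cconj v) (cconj w) = cnj (G v w)"
  by (simp add: ext_sesq_def cconj_def complex_eq_iff g.minus_left g.minus_right)

abbreviation q where "q v \<equiv> Re (G v v)"

lemma q_nonneg: "0 \<le> q v"
  by (simp add: ext_sesq_def g_nonneg)

lemma bounded_bilinear_Re_G: "bounded_bilinear (\<lambda>v w. Re (G v w))"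
proof -
  obtain K where K: "K > 0" "\<And>a b. norm (g a b) \<le> norm a * norm b * K"
    using g.pos_bounded by blast
  have fst_le: "norm (fst v) \<le> norm v" and snd_le: "norm (snd v) \<le> norm v" for v :: "'a \<times> 'a"
    using norm_fst_le[of "fst v" "snd v"] norm_snd_le[of "snd v" "fst v"] by simp_all
  have "norm (Re (G v w)) \<le> norm v * norm w * (2 * K)" for v w
  proof -
    have "norm (g (fst v) (fst w)) \<le> norm v * norm w * K"
      using K by (intro order_trans[OF K(2)] mult_mono fst_le mult_right_mono) auto
    moreover have "norm (g (snd v) (snd w)) \<le> norm v * norm w * K"
      using K by (intro order_trans[OF K(2)] mult_mono snd_le mult_right_mono) auto
    ultimately show ?thesis by (simp add: ext_sesq_def)
  qed
  thus ?thesis by unfold_locales (auto simp: G_linear intro!: exI[of _ "2 * K"])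
qed

lemma q_coercive: "\<exists>m>0. \<forall>v. m * (norm v)\<^sup>2 \<le> q v"
proof -
  obtain m where m: "m > 0" "\<And>v. m * (norm v)\<^sup>2 \<le> g v v" using g_coercive by blast
  have "m * (norm v)\<^sup>2 \<le> q v" for v :: "'a \<times> 'a"
    using m(2)[of "fst v"] m(2)[of "snd v"] 
    by (simp add: ext_sesq_def norm_prod_def algebra_simps)
  thus ?thesis using m by blast
qed

lemma q_bounded: "\<exists>M>0. \<forall>v. q v \<le> M * (norm v)\<^sup>2"
proof -
  obtain M where M: "M > 0" "\<And>v w. norm (Re (G v w)) \<le> norm v * norm w * M"
    using bounded_bilinear.pos_bounded[OF bounded_bilinear_Re_G] by blast
  have "q v \<le> M * (norm v)\<^sup>2" for v
    using M(2)[of v v] by (simp add: power2_eq_square mult_ac)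
  thus ?thesis using M by blast
qed

lemma q_eq_0_iff [simp]: "q v = 0 \<longleftrightarrow> v = 0"
proof
  obtain m where m: "m > 0" "\<And>v. m * (norm v)\<^sup>2 \<le> q v" using q_coercive by blast
  assume "q v = 0"
  thus "v = 0" using m(1) m(2)[of v] by (simp add: mult_le_0_iff)
qed simp

text \<open>
  The operator \<open>- \<i> J\<close>: the involution that is \<open>1\<close> on \<open>L\<^sup>+\<close> and \<open>- 1\<close> on \<open>L\<^sup>-\<close>
  (\<open>Lplus_iff\<close>, \<open>Lminus_iff\<close>). Working with it replaces the two eigenspaces by one symmetric operator.
\<close>

definition grading where "grading v = (J (snd v), - J (fst v))"

lemma grading_grading [simp]: "grading (grading v) = v"
  by (simp add: grading_def J.neg)

lemma grading_add: "grading (v + w) = grading v + grading w"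
  by (simp add: grading_def J.add)

lemma grading_cscale: "grading (c *\<^sub>c v) = c *\<^sub>c grading v"
  by (simp add: grading_def cscale_def J.add J.diff J.scaleR)

lemma grading_scaleR: "grading (r *\<^sub>R v) = r *\<^sub>R grading v"
  by (simp add: grading_def J.scaleR)

lemma grading_diff: "grading (v - w) = grading v - grading w"
  by (simp add: grading_def J.diff)

lemma grading_cconj: "grading (cconj v) = - cconj (grading v)"
  by (simp add: grading_def cconj_def J.neg)

lemma G_grading: "G (grading v) w = G v (grading w)"
  by (simp add: ext_sesq_def grading_def complex_eq_iff g.minus_left g.minus_right g_J_left)

text \<open>
  The indefinite Hermitian form \<open>- \<i> \<omega> (v, \<alpha> w)\<close> (see \<open>\<omega>_eq_h\<close>); all conditions on \<open>\<omega>\<close> are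
  expressed through it.
\<close>

definition h where "h v w = G (grading v) w"

lemma \<omega>_eq_h: "- \<i> * ext_bilin \<omega> v (cconj w) = h v w"
  by (simp add: ext_bilin_def h_def grading_def ext_sesq_def cconj_def \<omega>_eq complex_eq_iff g.minus_left g.minus_right)

lemma isotropic_iff: "isotropic \<omega> L \<longleftrightarrow> (\<forall>v\<in>L. \<forall>w\<in>cconj ` L. h v w = 0)"
proof -
  have "ext_bilin \<omega> v w = 0 \<longleftrightarrow> h v (cconj w) = 0" for v w
    using \<omega>_eq_h[of v "cconj w", symmetric] by (simp add: cconj_def)
  thus ?thesis by (auto simp: isotropic_def)
qed

lemma h_linear:
  "h (u + v) w = h u w + h v w" "h u (v + w) = h u v + h u w"
  "h (c *\<^sub>c v) w = c * h v w" "h v (c *\<^sub>c w) = cnj c * h v w"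
  "h (r *\<^sub>R v) w = r * h v w" "h v (r *\<^sub>R w) = r * h v w"
  by (simp_all add: h_def grading_add grading_cscale grading_scaleR G_linear)

lemma h_zero_right [simp]: "h v 0 = 0"
  by (simp add: h_def)

lemma h_cnj: "cnj (h v w) = h w v"
  by (simp add: h_def G_cnj G_grading)

lemma h_cconj: "h (cconj v) (cconj w) = - cnj (h v w)"
  by (simp add: h_def grading_cconj G_linear G_cconj)

lemma Lplus_iff: "v \<in> Lplus J \<longleftrightarrow> grading v = v"
  by (cases v) (auto simp: Lplus_def grading_def ext_op_def cscale_def zero_prod_def J.neg
      dest: arg_cong[of _ _ J])

lemma Lminus_iff: "v \<in> Lminus J \<longleftrightarrow> grading v = - v"
  by (cases v) (auto simp: Lminus_def grading_def ext_op_def cscale_def zero_prod_def J.neg eq_neg_iff_add_eq_0 add.commute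
      dest: arg_cong[of _ _ J])

lemma q_cconj [simp]: "q (cconj v) = q v"
  by (simp add: G_cconj)

lemma q_minus [simp]: "q (- v) = q v"
  by (simp add: G_linear)

lemma Re_G_commute: "Re (G v w) = Re (G w v)"
  by (subst G_cnj[symmetric]) simp

lemma q_add: "q (v + w) = q v + 2 * Re (G v w) + q w"
  using Re_G_commute[of v w] by (simp add: G_linear)

lemma q_add_le: "q (v + w) \<le> 2 * q v + 2 * q w"
  using q_nonneg[of "v - w"] Re_G_commute[of v w] by (simp add: G_linear)

lemma cvs_subspace_Lplus: "cvs.subspace (Lplus J)"
  using grading_scaleR[of 0]
  by (auto simp: cvs.subspace_def Lplus_iff grading_add grading_cscale)

lemma cvs_subspace_Lminus: "cvs.subspace (Lminus J)"
  using grading_scaleR[of 0]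
  by (auto simp: cvs.subspace_def Lminus_iff grading_add grading_cscale)

lemma cconj_Lplus: "v \<in> Lplus J \<Longrightarrow> cconj v \<in> Lminus J"
  by (simp add: Lplus_iff Lminus_iff grading_cconj)

lemma cconj_Lminus: "v \<in> Lminus J \<Longrightarrow> cconj v \<in> Lplus J"
  by (simp add: Lplus_iff Lminus_iff grading_cconj)
     (simp add: cconj_def)

lemma G_Lplus_Lminus: "u \<in> Lplus J \<Longrightarrow> v \<in> Lminus J \<Longrightarrow> G u v = 0"
  using G_grading[of u v] by (simp add: Lplus_iff Lminus_iff G_linear)

lemma G_Lminus_Lplus: "u \<in> Lminus J \<Longrightarrow> v \<in> Lplus J \<Longrightarrow> G u v = 0"
  using G_grading[of u v] by (simp add: Lplus_iff Lminus_iff G_linear)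

definition pplus where "pplus v = (1/2) *\<^sub>R (v + grading v)"
definition pminus where "pminus v = (1/2) *\<^sub>R (v - grading v)"

lemma pplus_in [simp]: "pplus v \<in> Lplus J"
  by (simp add: Lplus_iff pplus_def grading_scaleR grading_add add.commute)

lemma pminus_in [simp]: "pminus v \<in> Lminus J"
  by (simp add: Lminus_iff pminus_def grading_scaleR grading_diff scaleR_diff_right)

lemma pplus_pminus: "pplus v + pminus v = v"
  by (simp add: pplus_def pminus_def flip: scaleR_add_right scaleR_2)

lemma linear_pplus: "linear pplus"
  by (rule linearI) (simp_all add: pplus_def grading_add grading_scaleR algebra_simps)

lemma linear_pminus: "linear pminus"
  by (rule linearI) (simp_all add: pminus_def grading_add grading_scaleR algebra_simps)

lemma pplus_Lplus [simp]: "v \<in> Lplus J \<Longrightarrow> pplus v = v"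
  and pminus_Lplus [simp]: "v \<in> Lplus J \<Longrightarrow> pminus v = 0"
  by (simp_all add: Lplus_iff pplus_def pminus_def flip: scaleR_2)

lemma pplus_Lminus [simp]: "v \<in> Lminus J \<Longrightarrow> pplus v = 0"
  and pminus_Lminus [simp]: "v \<in> Lminus J \<Longrightarrow> pminus v = v"
  by (simp_all add: Lminus_iff pplus_def pminus_def flip: scaleR_2)

lemma orth_proj_eqI:
  assumes "cvs.subspace L" and p: "p \<in> L" "\<And>w. w \<in> L \<Longrightarrow> G (v - p) w = 0"
  shows "orth_proj g L v = p"
  unfolding orth_proj_def
proof (rule the_equality)
  fix p' assume p': "p' \<in> L \<and> (\<forall>w\<in>L. G (v - p') w = 0)"
  have "p' - p \<in> L" using p' p assms(1) by (simp add: cvs.subspace_diff)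
  hence "G (v - p) (p' - p) - G (v - p') (p' - p) = 0" using p' p by simp
  hence "q (p' - p) = 0" by (simp flip: G_linear(3))
  thus "p' = p" by simp
qed (use p in auto)

text \<open>
  The two eigenspaces are \<open>g\<close>-orthogonal, so the spectral projections \<open>(1 \<plusminus> S) / 2\<close> of the
  involution are the orthogonal projections.
\<close>

lemma Pplus_eq: "Pplus g J = pplus"
proof
  fix v
  have "v - pplus v = pminus v" using pplus_pminus[of v] by (simp add: algebra_simps)
  thus "Pplus g J v = pplus v"
    unfolding Pplus_def by (intro orth_proj_eqI cvs_subspace_Lplus) (simp_all add: G_Lminus_Lplus)
qed

lemma Pminus_eq: "Pminus g J = pminus"
proof
  fix v
  have "v - pminus v = pplus v" using pplus_pminus[of v] by (simp add: algebra_simps)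
  thus "Pminus g J v = pminus v"
    unfolding Pminus_def by (intro orth_proj_eqI cvs_subspace_Lminus) (simp_all add: G_Lplus_Lminus)
qed

lemma q_split: "q v = q (pplus v) + q (pminus v)"
  using q_add[of "pplus v" "pminus v"] by (simp add: pplus_pminus G_Lplus_Lminus)

lemma h_split: "Re (h v v) = q (pplus v) - q (pminus v)"
proof -
  have "grading v = pplus v - pminus v"
    by (simp add: pplus_def pminus_def flip: scaleR_diff_right scaleR_2)
  hence "h v v = G (pplus v - pminus v) (pplus v + pminus v)"
    by (simp add: h_def pplus_pminus)
  thus ?thesis by (simp add: G_linear G_Lplus_Lminus G_Lminus_Lplus)
qed

text \<open>
  Each of the two summands is an isotropic complement of the other, so being Lagrangian
  reduces to isotropy; and \<open>\<alpha>\<close> transports isotropy from \<open>W\<close> to \<open>\<alpha> W\<close>.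
\<close>

lemma Pol_iff:
  "W \<in> Pol \<omega> \<longleftrightarrow> cvs.subspace W \<and> (\<forall>v\<in>W. \<forall>w\<in>cconj ` W. h v w = 0)
     \<and> direct_sum W (cconj ` W) \<and> (\<forall>v\<in>W. v \<noteq> 0 \<longrightarrow> 0 < Re (h v v))"
proof -
  have real: "h v v \<in> \<real>" for v
    using h_cnj[of v v] by (simp add: complex_is_Real_iff complex_eq_iff)
  have iso: "isotropic \<omega> (cconj ` W)" if "\<forall>v\<in>W. \<forall>w\<in>cconj ` W. h v w = 0"
    using that h_cconj[of _ "cconj _"] by (auto simp: isotropic_iff)
  show ?thesis
    unfolding Pol_def lagrangian_def pos_def_on_def \<omega>_eq_h
    using cvs_subspace_cconj[of W] direct_sum_commute[of W "cconj ` W"] iso real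
    by (auto simp: isotropic_iff[of W])
qed

section \<open>Analysis on a positive polarization\<close>

text \<open>
  A strict contraction in the norm of \<open>g\<close> need not contract the norm of the type, but its
  iterates decay geometrically in both.
\<close>

lemma contraction_surj:
  assumes lin: "linear E" and k: "0 \<le> k" "k < 1" and contr: "\<And>y. q (E y) \<le> k * q y"
  shows "\<exists>x. x - E x = y"
proof -
  obtain m where m: "m > 0" "\<And>v. m * (norm v)\<^sup>2 \<le> q v" using q_coercive by blast
  obtain M where M: "M > 0" "\<And>v. q v \<le> M * (norm v)\<^sup>2" using q_bounded by blast
  have norm_le: "norm v \<le> sqrt (q v / m)" for v
    using m(2)[of v] m(1) by (intro real_le_rsqrt) (simp add: field_simps)
  have "bounded_linear E"
  proof (rule bounded_linear_intro)
    fix v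
    have "q (E v) \<le> k * (M * (norm v)\<^sup>2)"
      using contr[of v] M(2)[of v] k(1) by (meson mult_left_mono order_trans)
    hence "q (E v) / m \<le> k * M / m * (norm v)\<^sup>2"
      using m(1) by (simp add: field_simps)
    hence "sqrt (q (E v) / m) \<le> sqrt (k * M / m * (norm v)\<^sup>2)"
      by (rule real_sqrt_le_mono)
    also have "\<dots> = norm v * sqrt (k * M / m)"
      by (subst real_sqrt_mult) (simp add: mult.commute)
    finally show "norm (E v) \<le> norm v * sqrt (k * M / m)"
      using norm_le[of "E v"] by (rule order_trans[rotated])
  qed (simp_all add: linear_add[OF lin] linear_scale[OF lin])
  moreover have "norm ((E ^^ n) y) \<le> sqrt (q y / m) * sqrt k ^ n" for n
  proof -
    have "q ((E ^^ n) y) \<le> k ^ n * q y"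
    proof (induction n)
      case (Suc n)
      have "q ((E ^^ Suc n) y) \<le> k * q ((E ^^ n) y)" using contr by simp
      also have "\<dots> \<le> k * (k ^ n * q y)" using Suc k(1) by (intro mult_left_mono)
      finally show ?case by (simp add: mult.assoc)
    qed simp
    hence "sqrt (q ((E ^^ n) y) / m) \<le> sqrt (k ^ n * q y / m)"
      using m(1) by (intro real_sqrt_le_mono divide_right_mono) auto
    thus ?thesis
      using norm_le[of "(E ^^ n) y"]
      by (simp add: real_sqrt_mult real_sqrt_divide real_sqrt_power mult.commute)
  qed
  ultimately show ?thesis
    using k by (intro Neumann_surj[where r = "sqrt k"]) auto
qed

text \<open>
  Pointwise positivity of \<open>h\<close> on \<open>W\<close> improves to a uniform bound. The functionals
  \<open>h y\<close>, for \<open>y\<close> in the \<open>h\<close>-unit ball of \<open>W\<close>, are pointwise bounded: of \<open>z = w + v\<close> with \<open>v \<in> \<alpha> W\<close>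
  they see only \<open>w\<close>. Hence they are uniformly bounded, and evaluating \<open>h y\<close> at \<open>S y\<close>, where it is
  the squared \<open>g\<close>-norm of \<open>y\<close>, bounds \<open>y\<close>.
\<close>

lemma h_coercive:
  assumes W: "W \<in> Pol \<omega>"
  obtains c where "0 < c" "c \<le> 1" "\<And>w. w \<in> W \<Longrightarrow> c * q w \<le> Re (h w w)"
proof -
  have sub: "cvs.subspace W" and orth: "\<And>v w. v \<in> W \<Longrightarrow> w \<in> cconj ` W \<Longrightarrow> h v w = 0"
    and sum: "direct_sum W (cconj ` W)"
    and pos: "\<And>v. v \<in> W \<Longrightarrow> v \<noteq> 0 \<Longrightarrow> 0 < Re (h v v)"
    using W by (auto simp: Pol_iff)
  have rsub: "subspace W" using sub by (rule cvs_subspace_imp_subspace)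
  have nonneg: "0 \<le> Re (h v v)" if "v \<in> W" for v
    using pos[OF that] by (cases "v = 0") auto
  have bil: "bilinear (\<lambda>v w. Re (h v w))"
    unfolding bilinear_def by (intro conjI allI linearI) (simp_all add: h_linear)
  have sym: "Re (h v w) = Re (h w v)" for v w
    by (subst h_cnj[symmetric]) simp
  note CS = Cauchy_Schwarz_semidefinite[OF bil sym rsub nonneg]
  define Y where "Y = {y \<in> W. Re (h y y) \<le> 1}"
  define F where "F = (\<lambda>y z. Re (h y z)) ` Y"
  have "\<exists>K\<ge>0. \<forall>f\<in>F. \<forall>x. norm (f x) \<le> K * norm x"
  proof (rule uniform_boundedness_principle)
    fix f assume "f \<in> F"
    thus "bounded_linear f"
      unfolding F_def h_def
      by (elim imageE) (simp add: bounded_bilinear.bounded_linear_right[OF bounded_bilinear_Re_G])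
  next
    fix z
    obtain w v where wv: "w \<in> W" "v \<in> cconj ` W" "z = w + v"
      using sum unfolding direct_sum_def by blast
    have "norm (Re (h y z)) \<le> sqrt (Re (h w w))" if "y \<in> Y" for y
    proof -
      have y: "y \<in> W" "Re (h y y) \<le> 1" using that by (auto simp: Y_def)
      have "(Re (h y w))\<^sup>2 \<le> Re (h y y) * Re (h w w)" by (rule CS) (use y wv in auto)
      also have "\<dots> \<le> 1 * Re (h w w)" using y nonneg[OF wv(1)] by (intro mult_right_mono) auto
      finally have "\<bar>Re (h y w)\<bar> \<le> sqrt (Re (h w w))" by (simp add: real_le_rsqrt)
      moreover have "h y z = h y w" using wv orth y by (simp add: h_linear)
      ultimately show ?thesis by simp
    qed
    thus "\<exists>C. \<forall>f\<in>F. norm (f z) \<le> C" unfolding F_def by blast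
  qed
  then obtain K where K: "K \<ge> 0" "\<And>y z. y \<in> Y \<Longrightarrow> \<bar>Re (h y z)\<bar> \<le> K * norm z"
    by (auto simp: F_def)
  obtain m where m: "m > 0" "\<And>v. m * (norm v)\<^sup>2 \<le> q v" using q_coercive by blast
  define D where "D = K\<^sup>2 / m"
  have D: "D \<ge> 0" using m by (simp add: D_def)
  have q_le_D: "q y \<le> D" if "y \<in> Y" for y
  proof (cases "q y = 0")
    case False
    hence qpos: "q y > 0" using q_nonneg[of y] by linarith
    have "q y = Re (h y (grading y))" by (simp add: h_def G_grading)
    hence "q y \<le> K * norm (grading y)" using K(2)[OF that, of "grading y"] by simp
    hence "(q y)\<^sup>2 \<le> (K * norm (grading y))\<^sup>2" using q_nonneg by (rule power_mono)
    hence "m * (q y)\<^sup>2 \<le> K\<^sup>2 * (m * (norm (grading y))\<^sup>2)"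
      using m(1) by (simp add: power_mult_distrib)
    also have "\<dots> \<le> K\<^sup>2 * q (grading y)" using m(2) by (intro mult_left_mono) auto
    also have "q (grading y) = q y" by (simp add: G_grading)
    finally have "m * q y \<le> K\<^sup>2" using qpos by (simp add: power2_eq_square)
    thus ?thesis using m(1) by (simp add: D_def field_simps)
  qed (use D in simp)
  have "q w \<le> (D + 1) * Re (h w w)" if w: "w \<in> W" for w
  proof (cases "w = 0")
    case False
    define s where "s = Re (h w w)"
    have s: "s > 0" using pos[OF w False] by (simp add: s_def)
    define y where "y = (1 / sqrt s) *\<^sub>R w"
    have "y \<in> Y"
      using s w rsub by (auto simp: Y_def y_def h_linear subspace_scale simp flip: s_def)
    hence "q y \<le> D" by (rule q_le_D)
    moreover have "q y = q w / s" using s by (simp add: y_def)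
    ultimately show ?thesis using s by (simp add: field_simps flip: s_def)
  qed simp
  hence "1 / (D + 1) * q w \<le> Re (h w w)" if w: "w \<in> W" for w
    using that D by (simp add: field_simps)
  thus ?thesis using D by (intro that[of "1 / (D + 1)"]) auto
qed

text \<open>
  Let \<open>Q\<close> be the projection to \<open>W\<close> along \<open>\<alpha> W\<close>. For \<open>p \<in> L\<^sup>+\<close> put \<open>w = Q p\<close> and \<open>a = P\<^sup>+ w\<close>. Then
  \<open>g (a, p) = h w p = h w w \<ge> c \<parallel>a\<parallel>\<^sup>2\<close>, and the signs of \<open>h\<close> on \<open>W\<close> and \<open>\<alpha> W\<close> give \<open>\<parallel>p\<parallel> \<le> 2 \<parallel>a\<parallel>\<close>.
  Therefore \<open>\<parallel>p - c a\<parallel>\<^sup>2 \<le> (1 - c\<^sup>2 / 4) \<parallel>p\<parallel>\<^sup>2\<close>, so the operator \<open>c P\<^sup>+ Q\<close> on \<open>L\<^sup>+\<close> is onto,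
  and its values lie in \<open>P\<^sup>+ W\<close>.
\<close>

lemma Pol_pplus_surj:
  assumes W: "W \<in> Pol \<omega>" and x: "x \<in> Lplus J"
  shows "\<exists>w\<in>W. pplus w = x"
proof -
  have sub: "subspace W" "subspace (cconj ` W)"
    and orth: "\<And>v w. v \<in> W \<Longrightarrow> w \<in> cconj ` W \<Longrightarrow> h v w = 0"
    and sum: "direct_sum W (cconj ` W)"
    using W by (auto simp: Pol_iff cvs_subspace_imp_subspace cvs_subspace_cconj)
  obtain c where c: "0 < c" "c \<le> 1" "\<And>w. w \<in> W \<Longrightarrow> c * q w \<le> Re (h w w)"
    using h_coercive[OF W] by blast
  obtain Q where Q: "linear Q" "\<And>x. Q x \<in> W" "\<And>x. x - Q x \<in> cconj ` W"
    using direct_sum_projection[OF sub sum] by blast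
  \<comment> \<open>\<open>1 - E\<close> is \<open>c P\<^sup>+ Q\<close> on \<open>L\<^sup>+\<close>, extended by the identity on \<open>L\<^sup>-\<close>\<close>
  define E where "E y = pplus y - c *\<^sub>R pplus (Q (pplus y))" for y
  note lin [simp] = linear_add[OF Q(1)] linear_scale[OF Q(1)] linear_add[OF linear_pplus]
    linear_scale[OF linear_pplus]
  have "\<exists>y. y - E y = x"
  proof (rule contraction_surj)
    show "linear E" by (rule linearI) (simp_all add: E_def algebra_simps)
    show "0 \<le> 1 - c\<^sup>2 / 4" "1 - c\<^sup>2 / 4 < 1" using c power_le_one[of c 2] by auto
    fix y
    define p w a where "p = pplus y" and "w = Q p" and "a = pplus w"
    define v where "v = p - w"
    have p: "p \<in> Lplus J" by (simp add: p_def)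
    have w: "w \<in> W" and v: "v \<in> cconj ` W" using Q by (auto simp: w_def v_def)
    have pv: "pplus v = p - a" "pminus v = - pminus w"
      using p by (simp_all add: v_def a_def linear_diff[OF linear_pplus] linear_diff[OF linear_pminus])
    obtain u where u: "u \<in> W" "v = cconj u" using v by blast
    have nonneg: "0 \<le> Re (h u u)" if "u \<in> W" for u
      using c(3)[OF that] c(1) q_nonneg[of u] by (meson less_imp_le mult_nonneg_nonneg order_trans)
    have "Re (h v v) = - Re (h u u)" by (simp add: u(2) h_cconj)
    hence "q (p - a) \<le> q (pminus w)"
      using h_split[of v] nonneg[OF u(1)] by (simp add: pv)
    also have "\<dots> \<le> q a" using h_split[of w] nonneg[OF w] by (simp add: a_def)
    finally have "q p \<le> 4 * q a" using q_add_le[of a "p - a"] by simp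
    have "G a p = G w p"
      using p pplus_pminus[of w] G_Lminus_Lplus[of "pminus w" p]
      by (metis G_linear(1) a_def add.right_neutral pminus_in)
    also have "\<dots> = h w p" using p by (simp add: h_def G_grading Lplus_iff)
    also have "\<dots> = h w (w + v)" by (simp add: v_def)
    also have "\<dots> = h w w" using orth[OF w v] by (simp add: h_linear)
    finally have "Re (G a p) \<ge> c * q w" using c(3)[OF w] by simp
    moreover have "q w \<ge> q a" using q_split[of w] q_nonneg[of "pminus w"] by (simp add: a_def)
    ultimately have "Re (G a p) \<ge> c * q a" using c(1) by (meson less_imp_le mult_left_mono order_trans)
    hence "c * Re (G a p) \<ge> c * (c * q a)" using c(1) by (intro mult_left_mono) auto
    moreover have "q (E y) = q p - 2 * (c * Re (G a p)) + c * (c * q a)"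
      using Re_G_commute[of a p] by (simp add: E_def p_def w_def a_def G_linear algebra_simps)
    ultimately have "q (E y) \<le> q p - c\<^sup>2 * q a" by (simp add: power2_eq_square)
    also have "c\<^sup>2 * q p \<le> c\<^sup>2 * (4 * q a)" using \<open>q p \<le> 4 * q a\<close> by (intro mult_left_mono) auto
    hence "q p - c\<^sup>2 * q a \<le> (1 - c\<^sup>2 / 4) * q p" by (simp add: algebra_simps)
    also have "\<dots> \<le> (1 - c\<^sup>2 / 4) * q y"
      using q_split[of y] q_nonneg[of "pminus y"] c power_le_one[of c 2]
      by (intro mult_left_mono) (auto simp: p_def)
    finally show "q (E y) \<le> (1 - c\<^sup>2 / 4) * q y" .
  qed
  then obtain y where y: "y - E y = x" by blast
  have "pplus (c *\<^sub>R Q (pplus y)) = pplus (y - E y)"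
    by (simp add: E_def linear_diff[OF linear_pplus])
  moreover have "c *\<^sub>R Q (pplus y) \<in> W" using sub Q by (simp add: subspace_scale)
  ultimately show ?thesis using y x by (metis pplus_Lplus)
qed

text \<open>
  On the kernel of \<open>P\<^sup>+\<close> the form \<open>h\<close> is nonpositive, on \<open>W\<close> it is positive definite.
\<close>

lemma Pol_pplus_inj:
  assumes W: "W \<in> Pol \<omega>"
  shows "inj_on pplus W"
proof (rule inj_onI)
  fix v w assume vw: "v \<in> W" "w \<in> W" "pplus v = pplus w"
  hence "v - w \<in> W" using W by (simp add: Pol_iff cvs.subspace_diff)
  moreover have "Re (h (v - w) (v - w)) \<le> 0"
    using h_split[of "v - w"] q_nonneg[of "pminus (v - w)"] vw(3)
    by (simp add: linear_diff[OF linear_pplus] G_linear)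
  ultimately have "v - w = 0" using W by (force simp: Pol_iff)
  thus "v = w" by simp
qed

lemma Pol_pplus_bij:
  assumes W: "W \<in> Pol \<omega>"
  shows "bij_betw pplus W (Lplus J)"
  unfolding bij_betw_def
  using Pol_pplus_inj[OF W] Pol_pplus_surj[OF W] pplus_in by (auto simp: image_iff) metis

section \<open>The Siegel disk\<close>

lemma adj_eqI:
  assumes z: "z \<in> Lplus J" and y: "y \<in> Lminus J"
    and eq: "\<And>x. x \<in> Lplus J \<Longrightarrow> G (T x) y = G x z"
  shows "adj g (Lplus J) (Lminus J) T y = z"
proof -
  have "(THE z. z \<in> Lplus J \<and> (\<forall>x\<in>Lplus J. G (T x) y = G x z)) = z"
  proof (rule the_equality)
    fix z' assume z': "z' \<in> Lplus J \<and> (\<forall>x\<in>Lplus J. G (T x) y = G x z')"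
    have "z' - z \<in> Lplus J" using z z' cvs_subspace_Lplus by (simp add: cvs.subspace_diff)
    hence "G (z' - z) z' = G (z' - z) z" using z' eq by metis
    hence "q (z' - z) = 0" by (simp add: G_linear(4))
    thus "z' = z" by simp
  qed (use z eq in auto)
  thus ?thesis using y by (simp add: adj_def)
qed

lemma Riesz_g:
  assumes "bounded_linear f"
  obtains z where "\<And>u. f u = g z u"
proof -
  have "bij (to_dual g)"
    using triple unfolding compatible_triple_def strong_inner_product_def strong_form_def by blast
  then obtain z where "to_dual g z = Blinfun f" by (metis bij_pointE)
  hence "blinfun_apply (to_dual g z) = f" using assms by (simp add: bounded_linear_Blinfun_apply)
  hence "f u = g z u" for u
    by (metis to_dual_def bounded_linear_Blinfun_apply g.bounded_linear_right)
  thus ?thesis using that by blast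
qed

text \<open>
  The map \<open>u \<mapsto> (u, - J u)\<close> identifies \<open>H\<close> with \<open>L\<^sup>+\<close> and doubles the real part of \<open>g\<close>. So Riesz
  representation on \<open>H\<close>, which is the strength of \<open>g\<close>, represents the real part of
  \<open>x \<mapsto> g (T x, y)\<close>; the imaginary part follows by evaluating at \<open>\<i> x\<close>.
\<close>

lemma adj_exists:
  assumes T: "T \<in> bounded_ops g (Lplus J) (Lminus J)"
  shows "\<exists>z\<in>Lplus J. \<forall>x\<in>Lplus J. G (T x) y = G x z"
proof -
  have add: "\<And>x y. x \<in> Lplus J \<Longrightarrow> y \<in> Lplus J \<Longrightarrow> T (x + y) = T x + T y"
    and scale: "\<And>c x. x \<in> Lplus J \<Longrightarrow> T (c *\<^sub>c x) = c *\<^sub>c T x"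
    using T by (auto simp: bounded_ops_def)
  obtain K0 where K0: "\<And>x. x \<in> Lplus J \<Longrightarrow> gnorm g (T x) \<le> K0 * gnorm g x"
    using T unfolding bounded_ops_def by blast
  define K where "K = max K0 0"
  have gnorm_nonneg: "0 \<le> gnorm g v" for v by (simp add: gnorm_def q_nonneg)
  have K: "K \<ge> 0" "\<And>x. x \<in> Lplus J \<Longrightarrow> gnorm g (T x) \<le> K * gnorm g x"
  proof -
    fix x assume "x \<in> Lplus J"
    hence "gnorm g (T x) \<le> K0 * gnorm g x" by (rule K0)
    also have "\<dots> \<le> K * gnorm g x" using gnorm_nonneg by (intro mult_right_mono) (auto simp: K_def)
    finally show "gnorm g (T x) \<le> K * gnorm g x" .
  qed (simp add: K_def)
  obtain m where m: "m > 0" "\<And>v. m * (norm v)\<^sup>2 \<le> q v" using q_coercive by blast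
  obtain M where M: "M > 0" "\<And>v. q v \<le> M * (norm v)\<^sup>2" using q_bounded by blast
  obtain B where B: "B > 0" "\<And>v w. norm (Re (G v w)) \<le> norm v * norm w * B"
    using bounded_bilinear.pos_bounded[OF bounded_bilinear_Re_G] by blast
  define \<iota> where "\<iota> u = (u, - J u)" for u
  have \<iota>_in: "\<iota> u \<in> Lplus J" for u
    by (simp add: \<iota>_def Lplus_iff grading_def J.neg)
  have \<iota>_fst: "\<iota> (fst x) = x" if "x \<in> Lplus J" for x
    using that by (cases x) (simp add: \<iota>_def Lplus_iff grading_def)
  have \<iota>: "bounded_linear \<iota>"
    unfolding \<iota>_def by (intro bounded_linear_Pair bounded_linear_ident bounded_linear_minus bounded_linear_J)
  interpret \<iota>: bounded_linear \<iota> by (rule \<iota>)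
  have T_norm: "norm (T x) \<le> norm x * (K * sqrt M / sqrt m)" if "x \<in> Lplus J" for x
  proof -
    have "sqrt (m * (norm (T x))\<^sup>2) \<le> gnorm g (T x)"
      unfolding gnorm_def by (intro real_sqrt_le_mono m)
    also have "\<dots> \<le> K * gnorm g x" by (rule K(2)[OF that])
    also have "gnorm g x \<le> sqrt (M * (norm x)\<^sup>2)"
      unfolding gnorm_def by (intro real_sqrt_le_mono M)
    finally have "sqrt m * norm (T x) \<le> K * (sqrt M * norm x)"
      using K(1) by (simp add: real_sqrt_mult mult_left_mono)
    thus ?thesis using m(1) by (simp add: field_simps)
  qed
  have "bounded_linear (\<lambda>u. Re (G (T (\<iota> u)) y))"
  proof -
    have "bounded_linear (\<lambda>u. T (\<iota> u))"
    proof -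
      obtain N where N: "\<And>u. norm (\<iota> u) \<le> norm u * N" using \<iota>.bounded by blast
      have "norm (T (\<iota> u)) \<le> norm u * (N * (K * sqrt M / sqrt m))" for u
      proof -
        have "norm (T (\<iota> u)) \<le> norm (\<iota> u) * (K * sqrt M / sqrt m)" by (rule T_norm[OF \<iota>_in])
        also have "\<dots> \<le> norm u * N * (K * sqrt M / sqrt m)"
          using N K(1) M(1) m(1) by (intro mult_right_mono) auto
        finally show ?thesis by (simp add: mult.assoc)
      qed
      thus ?thesis
      proof (rule bounded_linear_intro[rotated 2])
        show "T (\<iota> (u + v)) = T (\<iota> u) + T (\<iota> v)" for u v
          by (simp add: \<iota>.add add \<iota>_in)
        show "T (\<iota> (r *\<^sub>R u)) = r *\<^sub>R T (\<iota> u)" for r u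
          by (simp add: \<iota>.scaleR scale \<iota>_in scaleR_eq_cscale)
      qed
    qed
    thus ?thesis
      using bounded_linear_compose[OF bounded_bilinear.bounded_linear_left[OF bounded_bilinear_Re_G]] by blast
  qed
  then obtain z0 where z0: "\<And>u. Re (G (T (\<iota> u)) y) = g z0 u" by (rule Riesz_g) blast
  \<comment> \<open>the factor compensates for the doubling of \<open>g\<close> under \<open>\<iota>\<close>\<close>
  define z where "z = \<iota> ((1/2) *\<^sub>R z0)"
  have z: "z \<in> Lplus J" by (simp add: z_def \<iota>_in)
  have Re_eq: "Re (G (T x) y) = Re (G x z)" if x: "x \<in> Lplus J" for x
  proof -
    have "Re (G (\<iota> (fst x)) z) = g z0 (fst x)"
      by (simp add: z_def \<iota>_def ext_sesq_def g_J_left J.scaleR g.scaleR_right g.scaleR_left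
          g.minus_left g.minus_right g_sym[of z0 "fst x"])
    thus ?thesis using z0[of "fst x"] \<iota>_fst[OF x] by simp
  qed
  have "G (T x) y = G x z" if x: "x \<in> Lplus J" for x
  proof (rule complex_eqI)
    have "\<i> *\<^sub>c x \<in> Lplus J" using cvs.subspace_scale[OF cvs_subspace_Lplus x] .
    hence "Re (G (T (\<i> *\<^sub>c x)) y) = Re (G (\<i> *\<^sub>c x) z)" by (rule Re_eq)
    thus "Im (G (T x) y) = Im (G x z)" using x by (simp add: scale)
  qed (rule Re_eq[OF x])
  thus ?thesis using z by blast
qed

text \<open>
  With the existence of adjoints, the two conditions on the adjoint become conditions on the form
  \<open>g\<close>: symmetry of \<open>\<alpha> Z\<close>, and a uniform gap between the norms of \<open>x\<close> and \<open>Z x\<close>.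
\<close>

lemma siegel_disk_iff:
  "Z \<in> siegel_disk g J \<longleftrightarrow> Z \<in> bounded_ops g (Lplus J) (Lminus J)
     \<and> (\<forall>x\<in>Lplus J. \<forall>y\<in>Lplus J. G (Z x) (cconj y) = G x (cconj (Z y)))
     \<and> (\<exists>c>0. \<forall>x\<in>Lplus J. c * q x \<le> q x - q (Z x))"
proof (cases "Z \<in> bounded_ops g (Lplus J) (Lminus J)")
  case True
  let ?A = "adj g (Lplus J) (Lminus J) Z"
  have Z_in: "Z x \<in> Lminus J" if "x \<in> Lplus J" for x
    using True that by (auto simp: bounded_ops_def)
  have A: "?A y \<in> Lplus J" "\<And>x. x \<in> Lplus J \<Longrightarrow> G (Z x) y = G x (?A y)" if y: "y \<in> Lminus J" for y
  proof -
    obtain z where z: "z \<in> Lplus J" "\<And>x. x \<in> Lplus J \<Longrightarrow> G (Z x) y = G x z"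
      using adj_exists[OF True, of y] by blast
    have "?A y = z" by (rule adj_eqI[OF z(1) y z(2)])
    thus "?A y \<in> Lplus J" "\<And>x. x \<in> Lplus J \<Longrightarrow> G (Z x) y = G x (?A y)" using z by auto
  qed
  have sym_iff: "(\<forall>x\<in>Lplus J. Z x = cconj (?A (cconj x)))
      \<longleftrightarrow> (\<forall>x\<in>Lplus J. \<forall>y\<in>Lplus J. G (Z x) (cconj y) = G x (cconj (Z y)))" (is "?L \<longleftrightarrow> ?R")
  proof
    assume L: ?L
    show ?R
    proof (intro ballI)
      fix x y assume "x \<in> Lplus J" "y \<in> Lplus J"
      moreover from this have "cconj (Z y) = ?A (cconj y)"
        using arg_cong[OF bspec[OF L, of y], of cconj] by (simp only: cconj_cconj)
      ultimately show "G (Z x) (cconj y) = G x (cconj (Z y))"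
        using A(2)[of "cconj y" x] by (simp add: cconj_Lplus)
    qed
  next
    assume R: ?R
    have "?A (cconj x) = cconj (Z x)" if "x \<in> Lplus J" for x
      by (rule adj_eqI) (use R that in \<open>blast intro: cconj_Lplus cconj_Lminus Z_in\<close>)+
    thus ?L by (metis cconj_cconj)
  qed
  have "Re (G x (x - ?A (Z x))) = q x - q (Z x)" if "x \<in> Lplus J" for x
    using A(2)[OF Z_in[OF that] that] by (simp add: G_linear)
  hence pos_iff: "pos_op g (Lplus J) (\<lambda>x. x - ?A (Z x)) \<longleftrightarrow> (\<exists>c>0. \<forall>x\<in>Lplus J. c * q x \<le> q x - q (Z x))"
    unfolding pos_op_def by (simp cong: ball_cong)
  show ?thesis by (simp only: siegel_disk_def mem_Collect_eq sym_iff pos_iff)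
qed (simp add: siegel_disk_def)

section \<open>Polarizations as graphs\<close>

lemma pol_to_disk_pplus:
  assumes W: "W \<in> Pol \<omega>" and w: "w \<in> W"
  shows "pol_to_disk g J W (pplus w) = pminus w"
  using inv_into_f_f[OF Pol_pplus_inj[OF W] w] by (simp add: pol_to_disk_def Pplus_eq Pminus_eq)

text \<open>
  With \<open>u = Z x\<close> and \<open>v = Z y\<close> the left-hand side expresses isotropy of the graph of \<open>Z\<close>, and
  the right-hand side expresses \<open>Z = \<alpha> Z\<^sup>* \<alpha>\<close>.
\<close>

lemma h_graph:
  assumes "x \<in> Lplus J" "y \<in> Lplus J" "u \<in> Lminus J" "v \<in> Lminus J"
  shows "h (x + u) (cconj (y + v)) = G x (cconj v) - G u (cconj y)"
proof -
  have "grading (x + u) = x - u" using assms by (simp add: grading_add Lplus_iff Lminus_iff)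
  hence "h (x + u) (cconj (y + v)) = G (x - u) (cconj y + cconj v)"
    by (simp add: h_def cconj_add)
  thus ?thesis
    using assms by (simp add: G_linear G_Lplus_Lminus G_Lminus_Lplus cconj_Lplus cconj_Lminus)
qed

text \<open>
  Every \<open>x \<in> L\<^sup>+\<close> lifts to a unique \<open>w \<in> W\<close>, and \<open>Z x = P\<^sup>- w\<close>; so every property of \<open>Z\<close> is a
  property of \<open>W\<close>. In particular \<open>h w w\<close> is the gap between the squared norms of \<open>x\<close> and
  \<open>Z x\<close>, and it is bounded below by coercivity.
\<close>

lemma pol_to_disk_in:
  assumes W: "W \<in> Pol \<omega>"
  shows "pol_to_disk g J W \<in> siegel_disk g J"
proof -
  let ?Z = "pol_to_disk g J W"
  have sub: "cvs.subspace W" and orth: "\<And>v w. v \<in> W \<Longrightarrow> w \<in> W \<Longrightarrow> h v (cconj w) = 0"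
    using W by (auto simp: Pol_iff)
  obtain c where c: "0 < c" "c \<le> 1" "\<And>w. w \<in> W \<Longrightarrow> c * q w \<le> Re (h w w)"
    using h_coercive[OF W] by blast
  have lift: "\<exists>w\<in>W. pplus w = x \<and> ?Z x = pminus w" if "x \<in> Lplus J" for x
    using Pol_pplus_surj[OF W that] pol_to_disk_pplus[OF W] by metis
  have pplus_cscale: "pplus (a *\<^sub>c v) = a *\<^sub>c pplus v" "pminus (a *\<^sub>c v) = a *\<^sub>c pminus v" for a v
    by (simp_all add: pplus_def pminus_def grading_cscale scaleR_eq_cscale
        cvs.scale_right_distrib cvs.scale_right_diff_distrib mult.commute)
  have cq: "c * q x \<le> q x - q (?Z x)" if x: "x \<in> Lplus J" for x
  proof -
    obtain w where w: "w \<in> W" "pplus w = x" "?Z x = pminus w" using lift[OF x] by blast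
    have "c * q x \<le> c * q w"
      using q_split[of w] q_nonneg[of "pminus w"] w(2) c(1) by (intro mult_left_mono) auto
    also have "\<dots> \<le> Re (h w w)" by (rule c(3)[OF w(1)])
    finally show ?thesis using h_split[of w] w by simp
  qed
  have "?Z \<in> bounded_ops g (Lplus J) (Lminus J)"
    unfolding bounded_ops_def
  proof (intro CollectI conjI ballI allI exI)
    show "?Z \<in> Lplus J \<rightarrow>\<^sub>E Lminus J"
      by (auto simp: pol_to_disk_def Pminus_eq)
  next
    fix x y assume xy: "x \<in> Lplus J" "y \<in> Lplus J"
    obtain v where v: "v \<in> W" "pplus v = x" "?Z x = pminus v" using lift[OF xy(1)] by blast
    obtain w where w: "w \<in> W" "pplus w = y" "?Z y = pminus w" using lift[OF xy(2)] by blast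
    have "v + w \<in> W" using v w sub by (simp add: cvs.subspace_add)
    from pol_to_disk_pplus[OF W this] show "?Z (x + y) = ?Z x + ?Z y"
      by (simp add: linear_add[OF linear_pplus] linear_add[OF linear_pminus] v w)
  next
    fix a x assume x: "x \<in> Lplus J"
    obtain v where v: "v \<in> W" "pplus v = x" "?Z x = pminus v" using lift[OF x] by blast
    have "a *\<^sub>c v \<in> W" using v sub by (simp add: cvs.subspace_scale)
    from pol_to_disk_pplus[OF W this] show "?Z (a *\<^sub>c x) = a *\<^sub>c ?Z x"
      by (simp add: pplus_cscale v)
  next
    fix x assume x: "x \<in> Lplus J"
    have "q (?Z x) \<le> q x" using cq[OF x] c(1) q_nonneg[of x] by (meson diff_ge_0_iff_ge less_imp_le mult_nonneg_nonneg order_trans)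
    thus "gnorm g (?Z x) \<le> 1 * gnorm g x" by (simp add: gnorm_def)
  qed
  moreover have "G (?Z x) (cconj y) = G x (cconj (?Z y))" if xy: "x \<in> Lplus J" "y \<in> Lplus J" for x y
  proof -
    obtain v where v: "v \<in> W" "pplus v = x" "?Z x = pminus v" using lift[OF xy(1)] by blast
    obtain w where w: "w \<in> W" "pplus w = y" "?Z y = pminus w" using lift[OF xy(2)] by blast
    have "h (pplus v + pminus v) (cconj (pplus w + pminus w)) = 0"
      using orth[OF v(1) w(1)] by (simp add: pplus_pminus)
    hence "h (x + pminus v) (cconj (y + pminus w)) = 0" by (simp only: v(2) w(2))
    thus ?thesis using xy by (simp add: h_graph v(3) w(3))
  qed
  ultimately show ?thesis using cq c(1) by (auto simp: siegel_disk_iff)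
qed

lemma graph_pol_to_disk:
  assumes W: "W \<in> Pol \<omega>"
  shows "graph J (pol_to_disk g J W) = W"
proof -
  have "Lplus J = pplus ` W" using Pol_pplus_bij[OF W] by (simp add: bij_betw_def)
  hence "graph J (pol_to_disk g J W) = (\<lambda>x. x + pol_to_disk g J W x) ` (pplus ` W)"
    unfolding graph_def by (simp only: Setcompr_eq_image Collect_mem_eq)
  also have "\<dots> = (\<lambda>w. pplus w + pol_to_disk g J W (pplus w)) ` W"
    by (simp only: image_image)
  also have "\<dots> = (\<lambda>w. w) ` W"
    by (rule image_cong) (simp_all add: pol_to_disk_pplus[OF W] pplus_pminus)
  finally show ?thesis by simp
qed

lemma graphI: "x \<in> Lplus J \<Longrightarrow> x + Z x \<in> graph J Z"
  unfolding graph_def by blast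

text \<open>
  The point that needs an argument is that \<open>graph Z\<close> and \<open>\<alpha> (graph Z)\<close> span. For \<open>y = p + \<alpha> m\<close> with
  \<open>p, m \<in> L\<^sup>+\<close>, the vector \<open>(p + Z p) + \<alpha> (m + Z m)\<close> lies in that sum and differs from \<open>y\<close> by
  \<open>Z p + \<alpha> Z m\<close>, whose squared norm is at most \<open>1 - c\<close> times that of \<open>y\<close> because the two terms
  are orthogonal; \<open>contraction_surj\<close> applies.
\<close>

lemma graph_in_Pol:
  assumes Z: "Z \<in> siegel_disk g J"
  shows "graph J Z \<in> Pol \<omega>"
proof -
  let ?W = "graph J Z"
  have ops: "Z \<in> bounded_ops g (Lplus J) (Lminus J)"
    and sym: "\<And>x y. x \<in> Lplus J \<Longrightarrow> y \<in> Lplus J \<Longrightarrow> G (Z x) (cconj y) = G x (cconj (Z y))"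
    using Z by (auto simp: siegel_disk_iff)
  obtain c0 where c0: "c0 > 0" "\<And>x. x \<in> Lplus J \<Longrightarrow> c0 * q x \<le> q x - q (Z x)"
    using Z by (auto simp: siegel_disk_iff)
  \<comment> \<open>keeps the contraction factor \<open>1 - c\<close> nonnegative when \<open>L\<^sup>+\<close> is trivial\<close>
  define c where "c = min c0 1"
  have c: "0 < c" "c \<le> 1" using c0 by (auto simp: c_def)
  have cq: "q (Z x) \<le> (1 - c) * q x" if "x \<in> Lplus J" for x
  proof -
    have "c * q x \<le> c0 * q x" using q_nonneg by (intro mult_right_mono) (auto simp: c_def)
    thus ?thesis using c0(2)[OF that] by (simp add: algebra_simps)
  qed
  have Z_in: "Z x \<in> Lminus J" if "x \<in> Lplus J" for x
    using ops that by (auto simp: bounded_ops_def)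
  have Z_add: "\<And>x y. x \<in> Lplus J \<Longrightarrow> y \<in> Lplus J \<Longrightarrow> Z (x + y) = Z x + Z y"
    and Z_scale: "\<And>a x. x \<in> Lplus J \<Longrightarrow> Z (a *\<^sub>c x) = a *\<^sub>c Z x"
    using ops by (auto simp: bounded_ops_def)
  have Z_scaleR: "Z (r *\<^sub>R x) = r *\<^sub>R Z x" if "x \<in> Lplus J" for r x
    using that by (simp add: scaleR_eq_cscale Z_scale)
  have Z0: "Z 0 = 0" using Z_scale[of 0 0] cvs.subspace_0[OF cvs_subspace_Lplus] by simp
  have sub: "cvs.subspace ?W"
    unfolding cvs.subspace_def
  proof (intro conjI ballI allI)
    show "0 \<in> ?W"
      using graphI[OF cvs.subspace_0[OF cvs_subspace_Lplus], of Z] Z0 by simp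
  next
    fix v w assume "v \<in> ?W" "w \<in> ?W"
    then obtain x y where xy: "x \<in> Lplus J" "y \<in> Lplus J" "v = x + Z x" "w = y + Z y"
      unfolding graph_def by blast
    hence "v + w = (x + y) + Z (x + y)" by (simp add: Z_add algebra_simps)
    moreover have "x + y \<in> Lplus J" using xy cvs.subspace_add[OF cvs_subspace_Lplus] by blast
    ultimately show "v + w \<in> ?W" unfolding graph_def by blast
  next
    fix a v assume "v \<in> ?W"
    then obtain x where x: "x \<in> Lplus J" "v = x + Z x" unfolding graph_def by blast
    hence "a *\<^sub>c v = a *\<^sub>c x + Z (a *\<^sub>c x)" by (simp add: Z_scale cvs.scale_right_distrib)
    moreover have "a *\<^sub>c x \<in> Lplus J" using x cvs.subspace_scale[OF cvs_subspace_Lplus] by blast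
    ultimately show "a *\<^sub>c v \<in> ?W" unfolding graph_def by blast
  qed
  have orth: "h v w = 0" if v: "v \<in> ?W" and w: "w \<in> cconj ` ?W" for v w
  proof -
    obtain w' where w': "w' \<in> ?W" "w = cconj w'" using w by (rule imageE)
    obtain x where x: "x \<in> Lplus J" "v = x + Z x" using v unfolding graph_def by blast
    obtain y where y: "y \<in> Lplus J" "w' = y + Z y" using w'(1) unfolding graph_def by blast
    show ?thesis using x y w'(2) by (simp add: h_graph Z_in sym)
  qed
  have pos: "0 < Re (h v v)" if v: "v \<in> ?W" "v \<noteq> 0" for v
  proof -
    obtain x where x: "x \<in> Lplus J" "v = x + Z x" using v(1) unfolding graph_def by blast
    have "x \<noteq> 0" using v(2) x Z0 by auto
    hence "q x > 0" using q_nonneg[of x] q_eq_0_iff[of x] by linarith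
    hence "c * q x > 0" using c by simp
    moreover have "Re (h v v) = q x - q (Z x)"
      using x Z_in[OF x(1)] h_split[of v]
      by (simp add: linear_add[OF linear_pplus] linear_add[OF linear_pminus])
    ultimately show ?thesis using cq[OF x(1)] by (simp add: algebra_simps)
  qed
  have "direct_sum ?W (cconj ` ?W)"
    unfolding direct_sum_def
  proof (intro conjI allI)
    have "v = 0" if v: "v \<in> ?W" "v \<in> cconj ` ?W" for v
      using orth[OF v] pos[OF v(1)] by force
    thus "?W \<inter> cconj ` ?W = {0}"
      using cvs.subspace_0[OF sub] cvs.subspace_0[OF cvs_subspace_cconj[OF sub]] by blast
  next
    fix v
    \<comment> \<open>\<open>m\<close> is the conjugate of the \<open>L\<^sup>-\<close>-component, so that both lie in \<open>L\<^sup>+\<close>\<close>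
    define p m where "p y = pplus y" and "m y = cconj (pminus y)" for y
    have pm: "p y \<in> Lplus J" "m y \<in> Lplus J" for y
      by (simp_all add: p_def m_def cconj_Lminus)
    define E where "E y = - (Z (p y) + cconj (Z (m y)))" for y
    have lin: "p (x + y) = p x + p y" "m (x + y) = m x + m y"
      "p (r *\<^sub>R x) = r *\<^sub>R p x" "m (r *\<^sub>R x) = r *\<^sub>R m x" for x y r
      by (simp_all add: p_def m_def linear_add[OF linear_pplus] linear_add[OF linear_pminus]
          linear_scale[OF linear_pplus] linear_scale[OF linear_pminus] cconj_add cconj_scaleR)
    have "\<exists>y. y - E y = v"
    proof (rule contraction_surj)
      show "linear E"
        by (rule linearI)
           (simp_all add: E_def lin Z_add pm Z_scaleR cconj_add cconj_scaleR scaleR_add_right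
             scaleR_diff_right)
      show "0 \<le> 1 - c" "1 - c < 1" using c by auto
      fix y
      have "q (E y) = q (Z (p y) + cconj (Z (m y)))" by (simp add: E_def del: minus_add_distrib)
      also have "\<dots> = q (Z (p y)) + q (Z (m y))"
        using G_Lminus_Lplus[OF Z_in[OF pm(1)] cconj_Lminus[OF Z_in[OF pm(2)]]] by (simp add: q_add)
      also have "\<dots> \<le> (1 - c) * q (p y) + (1 - c) * q (m y)"
        using cq pm by (intro add_mono) auto
      also have "\<dots> = (1 - c) * q y"
        using q_split[of y] by (simp add: p_def m_def algebra_simps)
      finally show "q (E y) \<le> (1 - c) * q y" .
    qed
    then obtain y where y: "y - E y = v" by blast
    have "v = (p y + Z (p y)) + cconj (m y + Z (m y))"
      using pplus_pminus[of y] by (simp add: E_def p_def m_def cconj_add algebra_simps flip: y)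
    thus "\<exists>x\<in>?W. \<exists>w\<in>cconj ` ?W. v = x + w"
      using pm unfolding graph_def by blast
  qed
  thus ?thesis using sub orth pos by (auto simp: Pol_iff)
qed

lemma pol_to_disk_graph:
  assumes Z: "Z \<in> siegel_disk g J"
  shows "pol_to_disk g J (graph J Z) = Z"
proof (rule extensionalityI[of _ "Lplus J"])
  have PiE: "Z \<in> Lplus J \<rightarrow>\<^sub>E Lminus J" using Z by (auto simp: siegel_disk_def bounded_ops_def)
  show "Z \<in> extensional (Lplus J)" using PiE by (simp add: PiE_def)
  show "pol_to_disk g J (graph J Z) \<in> extensional (Lplus J)" by (simp add: pol_to_disk_def)
  fix x assume x: "x \<in> Lplus J"
  have Zx: "Z x \<in> Lminus J" using PiE x by auto
  have "x + Z x \<in> graph J Z" using x by (rule graphI)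
  from pol_to_disk_pplus[OF graph_in_Pol[OF Z] this]
  show "pol_to_disk g J (graph J Z) x = Z x"
    using x Zx by (simp add: linear_add[OF linear_pplus] linear_add[OF linear_pminus])
qed

end

theorem proposition4p6:
  fixes g :: "'a::{real_inner, complete_space, second_countable_topology} \<Rightarrow> 'a \<Rightarrow> real"
    and J :: "'a \<Rightarrow> 'a"
    and \<omega> :: "'a \<Rightarrow> 'a \<Rightarrow> real"
  assumes "compatible_triple g J \<omega>"
  shows "(\<forall>W\<in>Pol \<omega>. bij_betw (Pplus g J) W (Lplus J) \<and> pol_to_disk g J W \<in> siegel_disk g J)
       \<and> (\<forall>Z\<in>siegel_disk g J. graph J Z \<in> Pol \<omega>)
       \<and> (\<forall>W\<in>Pol \<omega>. graph J (pol_to_disk g J W) = W)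
       \<and> (\<forall>Z\<in>siegel_disk g J. pol_to_disk g J (graph J Z) = Z)"
proof -
  interpret compatible g J \<omega> by (rule compatible.intro) (rule assms)
  show ?thesis
    using Pol_pplus_bij pol_to_disk_in graph_in_Pol graph_pol_to_disk pol_to_disk_graph
    by (simp add: Pplus_eq)
qed

end
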